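(* Let $u:\mathbb{R}\to\mathbb{R}$ be of class $\mathcal{C}^3$ with $u''(x)>\kappa$ for all $x\in\mathbb{R}$, for some $\kappa>0$, and assume that its free Gibbs measure $\mu:=\nu_u$ is centered. Let $\varphi$ be the free moment map of $\mu$, assumed to be of class $\mathcal{C}^4$ with $\varphi''>0$, and let $\mathscr{L}_\varphi$ and $\Gamma_\varphi$ be the associated Laplacian and carré du champ operator defined in the context. Then $\varphi'$ is an eigenfunction of $\mathscr{L}_\varphi$ associated with the eigenvalue $-1$: $$\mathscr{L}_\varphi\varphi'=-\varphi'\quad\text{on }\operatorname{supp}(\nu_\varphi),$$ and moreover $\Gamma_\varphi(\varphi')=\mathscr{J}\varphi'$, where $\Gamma_\varphi(f):=\Gamma_\varphi(f,f)$.
   Context: For a $\mathcal{C}^1$ function $f$ on $\mathbb{R}$, the free difference quotient is $\mathscr{J}f(x,y)=\frac{f(x)-f(y)}{x-y}$ if $x\neq y$ and $\mathscr{J}f(x,x)=f'(x)$. Free Gibbs measure: for a convex function $v:\mathbb{R}\to\mathbb{R}$, the free Gibbs measure $\nu_v$ is the unique minimizer, over Borel probability measures $\rho$ on $\mathbb{R}$, of $-\iint\log|t-s|\,d\rho(t)\,d\rho(s)+\int v(s)\,d\rho(s)$. Free moment map: for a centered probability measure $\mu\neq\delta_0$ on $\mathbb{R}$ with finite second moment, the free moment map of $\mu$ is the convex lower semicontinuous function $\varphi$ (considered up to translations) such that $\mu=(\varphi')_\sharp\nu_\varphi$, where $\nu_\varphi$ is the free Gibbs measure associated with $\varphi$.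 For $f$ of class $\mathcal{C}^2$ and $x\in\operatorname{supp}(\nu_\varphi)$, the Laplacian is $$\mathscr{L}_\varphi f(x)=2\int\frac{1}{x-y}\,\frac{f'(x)-\mathscr{J}f(x,y)}{\mathscr{J}\varphi'(x,y)}\,d\nu_\varphi(y)-f'(x)\,u'(\varphi'(x)),$$ improper integrals being understood as principal values. The carré du champ operator is the function of two variables $\Gamma_\varphi(f,g)=(\mathscr{J}\varphi')^{-1}\cdot\mathscr{J}f\cdot\mathscr{J}g$ (pointwise products and inverse). *)

theory Defs
  imports "HOL-Probability.Probability"
begin

definition class_C :: "nat \<Rightarrow> (real \<Rightarrow> real) \<Rightarrow> bool" where
  "class_C k f \<longleftrightarrow>
     (\<forall>j<k. \<forall>x. ((deriv ^^ j) f) differentiable (at x)) \<and>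
     continuous_on UNIV ((deriv ^^ k) f)"

definition free_difference_quotient :: "(real \<Rightarrow> real) \<Rightarrow> real \<Rightarrow> real \<Rightarrow> real" where
  "free_difference_quotient f x y = (if x = y then deriv f x else (f x - f y) / (x - y))"

definition measure_support :: "real measure \<Rightarrow> real set" where
  "measure_support \<rho> = {x. \<forall>U. open U \<and> x \<in> U \<longrightarrow> 0 < emeasure \<rho> U}"

definition centered :: "real measure \<Rightarrow> bool" where
  "centered \<rho> \<longleftrightarrow> integrable \<rho> (\<lambda>x. x) \<and> (LINT x|\<rho>. x) = 0"

subsection \<open>Free Gibbs measures\<close>

text \<open>The library has \<open>ln 0 = 0\<close> on the reals; the logarithmic energy needs \<open>log 0 = -\<infinity>\<close>,
  so that measures with atoms have infinite energy.\<close>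

definition ext_log :: "real \<Rightarrow> ereal" where
  "ext_log r = (if r = 0 then - \<infinity> else ereal (ln r))"

text \<open>Integral with values in the extended reals, as positive part minus negative part.
  On \<open>ereal\<close>, \<open>\<infinity> - \<infinity> = \<infinity>\<close>.\<close>

definition ext_integral :: "'a measure \<Rightarrow> ('a \<Rightarrow> ereal) \<Rightarrow> ereal" where
  "ext_integral M f =
     enn2ereal (\<integral>\<^sup>+ x. e2ennreal (f x) \<partial>M) - enn2ereal (\<integral>\<^sup>+ x. e2ennreal (- f x) \<partial>M)"

text \<open>Since \<open>\<infinity> + a = \<infinity>\<close> for every \<open>a\<close> in \<open>ereal\<close>, a measure with \<open>\<integral> v d\<rho> = \<infinity>\<close>
  has energy \<open>\<infinity>\<close>. If \<open>v\<close> is convex and tends to \<open>\<infinity>\<close> at both ends, \<open>v\<close> dominates the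
  logarithm, so \<open>\<integral> v d\<rho> < \<infinity>\<close> makes the logarithmic term well defined; the energy is
  then the usual one, with values in \<open>(-\<infinity>, \<infinity>]\<close>.\<close>

definition free_energy :: "(real \<Rightarrow> real) \<Rightarrow> real measure \<Rightarrow> ereal" where
  "free_energy v \<rho> =
     - ext_integral (\<rho> \<Otimes>\<^sub>M \<rho>) (\<lambda>(t, s). ext_log \<bar>t - s\<bar>) + ext_integral \<rho> (\<lambda>s. ereal (v s))"

text \<open>\<open>\<nu>\<close> is the unique minimizer of the energy over all Borel probability measures on the
  real line (the locale predicate \<open>real_distribution\<close>).\<close>

definition is_free_gibbs :: "(real \<Rightarrow> real) \<Rightarrow> real measure \<Rightarrow> bool" where
  "is_free_gibbs v \<nu> \<longleftrightarrow>
     is_arg_min (free_energy v) real_distribution \<nu> \<and>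
     (\<forall>\<rho>. is_arg_min (free_energy v) real_distribution \<rho> \<longrightarrow> \<rho> = \<nu>)"

text \<open>\<open>\<phi>\<close> is a representative, among its translates, of the free moment map of \<open>\<mu>\<close>.
  Only real-valued \<open>\<phi>\<close> are considered; for these, convexity on the whole line implies
  continuity, hence lower semicontinuity.\<close>

definition is_free_moment_map :: "real measure \<Rightarrow> (real \<Rightarrow> real) \<Rightarrow> bool" where
  "is_free_moment_map \<mu> \<phi> \<longleftrightarrow>
     convex_on UNIV \<phi> \<and> (\<exists>\<nu>. is_free_gibbs \<phi> \<nu> \<and> \<mu> = distr \<nu> borel (deriv \<phi>))"

subsection \<open>Principal values, Laplacian, carre du champ\<close>

definition truncated_integral :: "real measure \<Rightarrow> real \<Rightarrow> (real \<Rightarrow> real) \<Rightarrow> real \<Rightarrow> real" where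
  "truncated_integral \<nu> x g \<epsilon> = (LINT y:{y. \<epsilon> < \<bar>x - y\<bar>}|\<nu>. g y)"

definition pv_exists :: "real measure \<Rightarrow> real \<Rightarrow> (real \<Rightarrow> real) \<Rightarrow> bool" where
  "pv_exists \<nu> x g \<longleftrightarrow>
     (\<forall>\<epsilon>>0. set_integrable \<nu> {y. \<epsilon> < \<bar>x - y\<bar>} g) \<and>
     (\<exists>l. (truncated_integral \<nu> x g \<longlongrightarrow> l) (at_right 0))"

definition pv_integral :: "real measure \<Rightarrow> real \<Rightarrow> (real \<Rightarrow> real) \<Rightarrow> real" where
  "pv_integral \<nu> x g = Lim (at_right 0) (truncated_integral \<nu> x g)"

definition laplacian_integrand ::
    "(real \<Rightarrow> real) \<Rightarrow> (real \<Rightarrow> real) \<Rightarrow> real \<Rightarrow> real \<Rightarrow> real" where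
  "laplacian_integrand \<phi> f x y =
     1 / (x - y) * ((deriv f x - free_difference_quotient f x y)
                      / free_difference_quotient (deriv \<phi>) x y)"

text \<open>\<open>\<nu>\<close> stands for the free Gibbs measure of \<open>\<phi>\<close>, and \<open>u\<close> for the potential of the
  measure whose free moment map is \<open>\<phi>\<close>. The value is meaningful only where the principal
  value exists.\<close>

definition laplacian ::
    "(real \<Rightarrow> real) \<Rightarrow> (real \<Rightarrow> real) \<Rightarrow> real measure \<Rightarrow> (real \<Rightarrow> real) \<Rightarrow> real \<Rightarrow> real" where
  "laplacian u \<phi> \<nu> f x =
     2 * pv_integral \<nu> x (laplacian_integrand \<phi> f x) - deriv f x * deriv u (deriv \<phi> x)"

text \<open>An eigenfunction lies in the domain (class \<open>C\<^sup>2\<close>, with convergent principal values) and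
  does not vanish identically on the support.\<close>

definition laplacian_eigenfunction ::
    "(real \<Rightarrow> real) \<Rightarrow> (real \<Rightarrow> real) \<Rightarrow> real measure \<Rightarrow> (real \<Rightarrow> real) \<Rightarrow> real \<Rightarrow> bool" where
  "laplacian_eigenfunction u \<phi> \<nu> f c \<longleftrightarrow>
     class_C 2 f \<and>
     (\<exists>x\<in>measure_support \<nu>. f x \<noteq> 0) \<and>
     (\<forall>x\<in>measure_support \<nu>.
        pv_exists \<nu> x (laplacian_integrand \<phi> f x) \<and> laplacian u \<phi> \<nu> f x = c * f x)"

definition carre_du_champ ::
    "(real \<Rightarrow> real) \<Rightarrow> (real \<Rightarrow> real) \<Rightarrow> (real \<Rightarrow> real) \<Rightarrow> real \<Rightarrow> real \<Rightarrow> real" where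
  "carre_du_champ \<phi> f g x y =
     inverse (free_difference_quotient (deriv \<phi>) x y)
       * free_difference_quotient f x y * free_difference_quotient g x y"

end

theory Submission
  imports Defs
begin

text \<open>Write \<open>T = \<phi>'\<close>, so that \<open>\<mu>\<close> is the image of \<open>\<nu>\<close> under \<open>T\<close>. With \<open>f = T\<close> the integrand of the
  Laplacian becomes \<open>T' x / (T x - T y) - 1 / (x - y)\<close>. Formally, the Euler--Lagrange equations of
  the two minimisers, \<open>2 PV\<integral> 1 / (x - y) d\<nu>(y) = T x\<close> and \<open>2 PV\<integral> 1 / (s - t) d\<mu>(t) = u' s\<close> at \<open>s = T x\<close>,
  evaluate twice its integral to \<open>T' x * u' (T x) - T x\<close>, which is the eigenvalue equation. The pointwise
  form of these two equations is delicate: each principal value is a Hilbert transform of a measure.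

  The proof avoids Hilbert transforms. The two singularities cancel: the integrand is bounded in \<open>y\<close>,
  locally uniformly in \<open>x\<close> (\<open>hilbert_kernel_defect_bounded\<close>), so the principal value is an ordinary
  integral and depends continuously on \<open>x\<close>. It is therefore enough to have the Euler--Lagrange
  equations in the weak form \<open>\<integral>\<integral> (g x - g y) / (x - y) d\<nu> d\<nu> = \<integral> \<phi>' g d\<nu>\<close> (\<open>Schwinger_Dyson\<close>), which
  follows by comparing the energy of a minimiser with that of its image under \<open>x + t * g x\<close>. Using
  this for \<open>\<mu>\<close> with a test function \<open>k\<close> and for \<open>\<nu>\<close> with \<open>g = (k \<circ> T) / T'\<close> and subtracting yields the
  eigenvalue equation integrated against \<open>g\<close> (\<open>eigen_defect_weakly_zero\<close>); by continuity it holds at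
  every point of the support (\<open>eigen_defect_zero_on_support\<close>).

  The first variation needs a finite minimal energy, which follows from the uniqueness of the
  minimiser (\<open>free_gibbs_energy_finite\<close>). The passage to the ordinary integral needs a measure without
  atoms, and finite energy excludes atoms (\<open>free_gibbs_no_atoms\<close>). Absence of atoms also makes \<open>T\<close> nonzero
  somewhere on the support: the support has at least two points, and \<open>T\<close> is injective.\<close>

section \<open>Integrals with values in the extended reals\<close>

lemma ext_integral_distr:
  assumes "f \<in> measurable M N" "h \<in> borel_measurable N"
  shows "ext_integral (distr M N f) h = ext_integral M (\<lambda>x. h (f x))"
  unfolding ext_integral_def using assms
  by (subst (1 2) nn_integral_distr) auto

text \<open>An integral that is allowed to be infinite moves by a finite amount under a bounded change of
  the integrand, and it does so in all cases, infinite or undetermined. This is what makes the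
  energy comparable along a perturbation before anything is known about its finiteness.\<close>
lemma ext_integral_add_bounded:
  fixes f :: "'a \<Rightarrow> ereal" and b :: "'a \<Rightarrow> real"
  assumes fin: "finite_measure M"
    and f[measurable]: "f \<in> borel_measurable M" and b[measurable]: "b \<in> borel_measurable M"
    and bound: "\<And>x. \<bar>b x\<bar> \<le> B"
  shows "ext_integral M (\<lambda>x. f x + ereal (b x)) = ext_integral M f + ereal (\<integral>x. b x \<partial>M)"
proof -
  interpret finite_measure M by fact
  have int_b: "integrable M b"
    by (rule integrable_const_bound[where B=B]) (auto simp: bound)
  define P where "P = (\<integral>\<^sup>+x. e2ennreal (f x) \<partial>M)"
  define N where "N = (\<integral>\<^sup>+x. e2ennreal (- f x) \<partial>M)"
  define P' where "P' = (\<integral>\<^sup>+x. e2ennreal (f x + ereal (b x)) \<partial>M)"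
  define N' where "N' = (\<integral>\<^sup>+x. e2ennreal (- (f x + ereal (b x))) \<partial>M)"
  define Bp where "Bp = (\<integral>\<^sup>+x. ennreal (b x) \<partial>M)"
  define Bn where "Bn = (\<integral>\<^sup>+x. ennreal (- b x) \<partial>M)"
  note defs = P_def N_def P'_def N'_def Bp_def Bn_def
  have Bp_fin: "Bp < \<infinity>" and Bn_fin: "Bn < \<infinity>"
    using int_b by (auto simp: real_integrable_def defs less_top)
  have int_b_eq: "(\<integral>x. b x \<partial>M) = enn2real Bp - enn2real Bn"
    using real_lebesgue_integral_def[OF int_b] by (simp add: defs)
  \<comment> \<open>\<open>(a + c)\<^sup>+ + a\<^sup>- + c\<^sup>- = (a + c)\<^sup>- + a\<^sup>+ + c\<^sup>+\<close>: no subtraction, so it also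
    holds for infinite \<open>a\<close> and can be integrated.\<close>
  have balance: "e2ennreal (a + ereal c) + e2ennreal (- a) + ennreal (- c)
      = e2ennreal (- (a + ereal c)) + e2ennreal a + ennreal c" for a c
  proof (cases a)
    case (real r)
    show ?thesis
      by (cases "0 \<le> r"; cases "0 \<le> c"; cases "0 \<le> r + c")
        (auto simp: real ennreal_neg simp flip: ennreal_plus intro!: arg_cong[where f=ennreal])
  qed (auto simp: e2ennreal_neg)
  have sub: "e2ennreal (a + ereal c) \<le> e2ennreal a + ennreal c" for a c
  proof (cases a)
    case (real r)
    show ?thesis
      by (cases "0 \<le> r"; cases "0 \<le> c")
        (auto simp: real ennreal_neg simp flip: ennreal_plus intro!: ennreal_leI)
  qed (auto simp: e2ennreal_neg)
  have cancel: "a + ereal c + ereal (- c) = a" for a c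
    by (cases a) auto
  have neg: "- (a + ereal c) = - a + ereal (- c)" for a c
    by (cases a) auto
  have sub': "e2ennreal a \<le> e2ennreal (a + ereal c) + ennreal (- c)" for a c
    using sub[of "a + ereal c" "- c"] by (simp only: cancel)
  have sum: "P' + N + Bn = N' + P + Bp"
    unfolding defs by (simp flip: nn_integral_add add: balance)
  have "P' \<le> P + Bp"
    unfolding defs by (simp flip: nn_integral_add add: sub nn_integral_mono)
  moreover have "N' \<le> N + Bn"
    unfolding defs neg by (simp flip: nn_integral_add add: sub nn_integral_mono)
  moreover have "P \<le> P' + Bn"
    unfolding defs by (simp flip: nn_integral_add add: sub' nn_integral_mono)
  moreover have "N \<le> N' + Bp"
    unfolding defs neg using sub'[of "- f x" "- b x" for x]
    by (simp flip: nn_integral_add add: nn_integral_mono)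
  ultimately have "(P = \<infinity> \<longleftrightarrow> P' = \<infinity>)" "(N = \<infinity> \<longleftrightarrow> N' = \<infinity>)"
    using Bp_fin Bn_fin by (auto simp: top_unique)
  then have "enn2ereal P' - enn2ereal N' = enn2ereal P - enn2ereal N + ereal (enn2real Bp - enn2real Bn)"
    using sum Bp_fin Bn_fin
    by (cases P; cases N; cases P'; cases N'; cases Bp; cases Bn)
      (auto simp: enn2ereal_ennreal simp flip: ennreal_plus)
  then show ?thesis
    unfolding ext_integral_def int_b_eq by (simp add: defs)
qed

section \<open>Transport of the free energy along perturbations of the identity\<close>

lemma real_distribution_distr_borel:
  assumes "real_distribution \<nu>" "f \<in> borel_measurable borel"
  shows "real_distribution (distr \<nu> borel f)"
proof -
  interpret real_distribution \<nu> by fact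
  show ?thesis using assms(2) by (intro real_distribution_distr) simp
qed

lemma ext_log_measurable [measurable]: "ext_log \<in> borel_measurable borel"
  unfolding ext_log_def[abs_def] by measurable

text \<open>Unlike the free difference quotient this is \<open>0\<close> on the diagonal (division by zero), which
  suits test functions that are only Lipschitz. The two agree off the diagonal, a null set for
  the product of a measure without atoms with itself.\<close>
definition difference_quotient :: "(real \<Rightarrow> real) \<Rightarrow> real \<Rightarrow> real \<Rightarrow> real" where
  "difference_quotient g x y = (g x - g y) / (x - y)"

lemma difference_quotient_measurable [measurable]:
  assumes [measurable]: "g \<in> borel_measurable borel"
  shows "(\<lambda>z. difference_quotient g (fst z) (snd z)) \<in> borel_measurable (borel \<Otimes>\<^sub>M borel)"
  unfolding difference_quotient_def by measurable

lemma difference_quotient_bound: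
  assumes "L-lipschitz_on UNIV g"
  shows "\<bar>difference_quotient g x y\<bar> \<le> L"
proof (cases "x = y")
  case True
  then show ?thesis using lipschitz_on_nonneg[OF assms] by (simp add: difference_quotient_def)
next
  case False
  then show ?thesis
    using lipschitz_onD[OF assms, of x y]
    by (simp add: difference_quotient_def dist_real_def divide_le_eq abs_divide)
qed

lemma abs_ln_one_plus_le:
  fixes s :: real
  assumes "\<bar>s\<bar> \<le> 1/2"
  shows "\<bar>ln (1 + s)\<bar> \<le> 1"
proof -
  have "s\<^sup>2 \<le> (1/2)\<^sup>2" using assms by (intro abs_le_square_iff[THEN iffD1]) simp
  then show ?thesis
    using abs_ln_one_plus_x_minus_x_bound[OF assms] assms by (simp add: power2_eq_square)
qed

text \<open>Transport along \<open>S x = x + g x\<close> multiplies \<open>\<bar>x - y\<bar>\<close> by \<open>1 + q\<close>, where \<open>q\<close> is the difference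
  quotient of \<open>g\<close>; the logarithm turns this into a bounded additive term, also on the diagonal,
  where both logarithms are \<open>-\<infinity>\<close>.\<close>
lemma free_energy_perturbation:
  assumes \<nu>: "real_distribution \<nu>"
    and v[measurable]: "v \<in> borel_measurable borel"
    and lip: "(1/2)-lipschitz_on UNIV g"
    and bound: "\<And>x. \<bar>v (x + g x) - v x\<bar> \<le> B"
  shows "free_energy v (distr \<nu> borel (\<lambda>x. x + g x)) = free_energy v \<nu> +
    ereal ((\<integral>x. v (x + g x) - v x \<partial>\<nu>)
      - (\<integral>z. ln (1 + difference_quotient g (fst z) (snd z)) \<partial>(\<nu> \<Otimes>\<^sub>M \<nu>)))"
proof -
  interpret real_distribution \<nu> by fact
  interpret P: pair_prob_space \<nu> \<nu> ..
  have "continuous_on UNIV g"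
    using lip by (rule lipschitz_on_continuous_on)
  then have g[measurable]: "g \<in> borel_measurable borel"
    by (rule borel_measurable_continuous_onI)
  define S where "S = (\<lambda>x. x + g x)"
  have S[measurable]: "S \<in> borel_measurable borel"
    unfolding S_def by measurable
  define \<rho> where "\<rho> = distr \<nu> borel S"
  interpret \<rho>: real_distribution \<rho>
    unfolding \<rho>_def using \<nu> S by (rule real_distribution_distr_borel)
  let ?D = "\<lambda>z. ln (1 + difference_quotient g (fst z) (snd z))"
  have sets_\<nu>2[measurable_cong]: "sets (\<nu> \<Otimes>\<^sub>M \<nu>) = sets (borel \<Otimes>\<^sub>M borel)"
    by (intro sets_pair_measure_cong) auto
  have pair: "\<rho> \<Otimes>\<^sub>M \<rho> = distr (\<nu> \<Otimes>\<^sub>M \<nu>) (borel \<Otimes>\<^sub>M borel) (\<lambda>(x, y). (S x, S y))"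
    unfolding \<rho>_def
    by (rule pair_measure_distr) (auto intro: \<rho>.sigma_finite_measure[unfolded \<rho>_def])
  have log_eq: "ext_log \<bar>S x - S y\<bar> = ext_log \<bar>x - y\<bar> + ereal (ln (1 + difference_quotient g x y))" for x y
  proof (cases "x = y")
    case False
    have q: "1 + difference_quotient g x y > 0"
      using difference_quotient_bound[OF lip, of x y] by auto
    have "S x - S y = (x - y) * (1 + difference_quotient g x y)"
      using False by (simp add: S_def difference_quotient_def field_simps)
    then have "\<bar>S x - S y\<bar> = \<bar>x - y\<bar> * (1 + difference_quotient g x y)"
      using q by (simp add: abs_mult)
    then show ?thesis using False q by (simp add: ext_log_def ln_mult)
  qed (simp add: ext_log_def)
  have "ext_integral (\<rho> \<Otimes>\<^sub>M \<rho>) (\<lambda>(t, s). ext_log \<bar>t - s\<bar>)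
      = ext_integral (\<nu> \<Otimes>\<^sub>M \<nu>) (\<lambda>z. (case z of (t, s) \<Rightarrow> ext_log \<bar>t - s\<bar>) + ereal (?D z))"
    unfolding pair by (subst ext_integral_distr) (auto simp: case_prod_beta log_eq)
  also have "\<dots> = ext_integral (\<nu> \<Otimes>\<^sub>M \<nu>) (\<lambda>(t, s). ext_log \<bar>t - s\<bar>) + ereal (\<integral>z. ?D z \<partial>(\<nu> \<Otimes>\<^sub>M \<nu>))"
    by (rule ext_integral_add_bounded[where B=1])
      (auto intro!: abs_ln_one_plus_le difference_quotient_bound[OF lip] P.finite_measure_axioms)
  finally have log_part: "ext_integral (\<rho> \<Otimes>\<^sub>M \<rho>) (\<lambda>(t, s). ext_log \<bar>t - s\<bar>) = \<dots>" .
  have "ext_integral \<rho> (\<lambda>s. ereal (v s)) = ext_integral \<nu> (\<lambda>s. ereal (v s) + ereal (v (S s) - v s))"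
    unfolding \<rho>_def by (subst ext_integral_distr) auto
  also have "\<dots> = ext_integral \<nu> (\<lambda>s. ereal (v s)) + ereal (\<integral>s. v (S s) - v s \<partial>\<nu>)"
    by (rule ext_integral_add_bounded[where B=B])
      (auto simp: S_def bound finite_measure_axioms)
  finally have v_part: "ext_integral \<rho> (\<lambda>s. ereal (v s)) = \<dots>" .
  have arith: "- (a + ereal d) + (b + ereal w) = - a + b + ereal (w - d)" for a b d w
    by (cases a; cases b) auto
  show ?thesis
    using log_part v_part
    by (simp add: free_energy_def arith S_def \<rho>_def)
qed

section \<open>Finite energy and absence of atoms\<close>

lemma free_gibbs_real_distribution: "is_free_gibbs v \<nu> \<Longrightarrow> real_distribution \<nu>"
  by (simp add: is_free_gibbs_def is_arg_min_def)

lemma free_gibbs_minimal: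
  "is_free_gibbs v \<nu> \<Longrightarrow> real_distribution \<rho> \<Longrightarrow> free_energy v \<nu> \<le> free_energy v \<rho>"
  by (auto simp: is_free_gibbs_def is_arg_min_def not_less)

lemma free_gibbs_unique:
  "is_free_gibbs v \<nu> \<Longrightarrow> real_distribution \<rho> \<Longrightarrow> free_energy v \<rho> \<le> free_energy v \<nu> \<Longrightarrow> \<rho> = \<nu>"
  by (auto simp: is_free_gibbs_def is_arg_min_def not_less intro: order_trans)

lemma bounded_perturbation_difference:
  fixes v g :: "real \<Rightarrow> real"
  assumes v: "continuous_on UNIV v" and g: "continuous_on UNIV g"
    and supp: "\<And>x. R < \<bar>x\<bar> \<Longrightarrow> g x = 0"
  shows "\<exists>B. \<forall>x. \<bar>v (x + g x) - v x\<bar> \<le> B"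
proof -
  have "continuous_on {-R..R} (\<lambda>x. v (x + g x) - v x)"
    by (intro continuous_intros continuous_on_compose2[OF v] continuous_on_subset[OF g]
        continuous_on_subset[OF v]) auto
  then have "bounded ((\<lambda>x. v (x + g x) - v x) ` {-R..R})"
    by (intro compact_imp_bounded compact_continuous_image) auto
  then obtain B where B: "\<And>x. x \<in> {-R..R} \<Longrightarrow> \<bar>v (x + g x) - v x\<bar> \<le> B"
    unfolding bounded_iff real_norm_def by blast
  have "\<bar>v (x + g x) - v x\<bar> \<le> max B 0" for x
  proof (cases "R < \<bar>x\<bar>")
    case False
    then have "x \<in> {-R..R}" by auto
    then show ?thesis using B by (simp add: le_max_iff_disj)
  qed (simp add: supp)
  then show ?thesis by blast
qed

lemma hat_lipschitz: "1-lipschitz_on UNIV (\<lambda>x::real. max 0 (r - \<bar>x - c\<bar>))"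
  by (rule lipschitz_onI) (auto simp: dist_real_def)

lemma half_hat_lipschitz: "(1/2)-lipschitz_on UNIV (\<lambda>x::real. max 0 (r - \<bar>x\<bar>) / 2)"
proof (rule lipschitz_onI)
  fix x y :: real
  show "dist (max 0 (r - \<bar>x\<bar>) / 2) (max 0 (r - \<bar>y\<bar>) / 2) \<le> 1 / 2 * dist x y"
    using lipschitz_onD[OF hat_lipschitz[of r 0], of x y]
    by (simp add: dist_real_def flip: diff_divide_distrib)
qed simp

text \<open>Finiteness of the minimal energy comes from uniqueness of the minimiser. If the energy were
  \<open>\<infinity>\<close>, every measure would be a minimiser, and two Dirac masses would coincide. If it were \<open>-\<infinity>\<close>, so
  would be the energy of every compactly supported perturbation of the measure, and the measure
  would be invariant under \<open>x \<mapsto> x + g x\<close> for hat functions \<open>g\<close>; since \<open>g \<ge> 0\<close>, invariance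
  forces \<open>g = 0\<close> almost everywhere, for hats of any width.\<close>
lemma free_gibbs_energy_finite:
  assumes gibbs: "is_free_gibbs v \<nu>" and v: "continuous_on UNIV v"
  shows "\<bar>free_energy v \<nu>\<bar> \<noteq> \<infinity>"
proof -
  interpret real_distribution \<nu>
    using gibbs by (rule free_gibbs_real_distribution)
  have \<nu>: "real_distribution \<nu>" ..
  have [measurable]: "v \<in> borel_measurable borel"
    using v by (rule borel_measurable_continuous_onI)
  have "free_energy v \<nu> \<noteq> \<infinity>"
  proof
    assume inf: "free_energy v \<nu> = \<infinity>"
    have dirac: "real_distribution (return borel (a::real))" for a
      by (simp add: real_distribution_def real_distribution_axioms_def prob_space_return)
    then have "return borel a = \<nu>" for a
      using inf by (intro free_gibbs_unique[OF gibbs]) auto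
    then have "return borel (0::real) = return borel 1" by metis
    then have "emeasure (return borel (0::real)) {0} = emeasure (return borel (1::real)) {0}"
      by simp
    then show False by simp
  qed
  moreover have "free_energy v \<nu> \<noteq> - \<infinity>"
  proof
    assume inf: "free_energy v \<nu> = - \<infinity>"
    have null: "AE x in \<nu>. real n \<le> \<bar>x\<bar>" for n
    proof -
      define g where "g = (\<lambda>x. max 0 (real n - \<bar>x\<bar>) / 2)"
      have lip: "(1/2)-lipschitz_on UNIV g"
        unfolding g_def by (rule half_hat_lipschitz)
      have g: "continuous_on UNIV g"
        using lip by (rule lipschitz_on_continuous_on)
      then have [measurable]: "g \<in> borel_measurable borel"
        by (rule borel_measurable_continuous_onI)
      obtain B where B: "\<And>x. \<bar>v (x + g x) - v x\<bar> \<le> B"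
        using bounded_perturbation_difference[OF v g, of "real n"] by (auto simp: g_def)
      have "free_energy v (distr \<nu> borel (\<lambda>x. x + g x)) = - \<infinity>"
        by (subst free_energy_perturbation[where g=g and v=v and B=B, OF \<nu> _ lip B]) (auto simp: inf)
      then have fixed: "distr \<nu> borel (\<lambda>x. x + g x) = \<nu>"
        by (intro free_gibbs_unique[OF gibbs] real_distribution_distr_borel[OF \<nu>]) auto
      \<comment> \<open>Compare the integrals of one bounded, strictly increasing function.\<close>
      have bnd: "\<bar>arctan x\<bar> \<le> 2" for x
        using arctan_bounded[of x] pi_half_less_two by auto
      have int: "integrable \<nu> (\<lambda>x. arctan (f x))" if [measurable]: "f \<in> borel_measurable borel" for f
        by (rule integrable_const_bound[where B=2]) (auto simp: bnd)
      have "(\<integral>x. arctan x \<partial>\<nu>) = (\<integral>x. arctan (x + g x) \<partial>\<nu>)"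
        by (subst fixed[symmetric], subst integral_distr) auto
      then have "(\<integral>x. arctan (x + g x) - arctan x \<partial>\<nu>) = 0"
        by (simp add: int)
      moreover have "g x \<ge> 0" for x by (simp add: g_def)
      ultimately have "AE x in \<nu>. arctan (x + g x) - arctan x = 0"
        by (subst (asm) integral_nonneg_eq_0_iff_AE) (auto simp: int arctan_le_iff)
      then show ?thesis
        by eventually_elim (auto simp: arctan_eq_iff g_def max_def split: if_splits)
    qed
    then have "AE x in \<nu>. \<forall>n. real n \<le> \<bar>x\<bar>" by (simp add: AE_all_countable)
    moreover have "\<not> (\<forall>n. real n \<le> \<bar>x\<bar>)" for x :: real
      using reals_Archimedean2[of "\<bar>x\<bar>"] by (auto simp: not_le)
    ultimately show False by simp
  qed
  ultimately show ?thesis by auto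
qed

lemma ext_integral_finiteD:
  assumes "\<bar>ext_integral M f\<bar> \<noteq> \<infinity>"
  shows "(\<integral>\<^sup>+ x. e2ennreal (- f x) \<partial>M) \<noteq> \<infinity>"
  using assms unfolding ext_integral_def
  by (cases "\<integral>\<^sup>+ x. e2ennreal (f x) \<partial>M"; cases "\<integral>\<^sup>+ x. e2ennreal (- f x) \<partial>M")
    (auto simp: enn2ereal_ennreal)

text \<open>A finite logarithmic energy excludes mass on the diagonal, where the logarithm is \<open>-\<infinity>\<close>.\<close>
lemma free_gibbs_no_atoms:
  assumes gibbs: "is_free_gibbs v \<nu>" and v: "continuous_on UNIV v"
  shows "emeasure \<nu> {x} = 0"
proof -
  interpret real_distribution \<nu>
    using gibbs by (rule free_gibbs_real_distribution)
  have sets_\<nu>2[measurable_cong]: "sets (\<nu> \<Otimes>\<^sub>M \<nu>) = sets (borel \<Otimes>\<^sub>M borel)"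
    by (intro sets_pair_measure_cong) auto
  have "\<bar>ext_integral (\<nu> \<Otimes>\<^sub>M \<nu>) (\<lambda>(t, s). ext_log \<bar>t - s\<bar>)\<bar> \<noteq> \<infinity>"
    using free_gibbs_energy_finite[OF assms] unfolding free_energy_def
    by (cases "ext_integral (\<nu> \<Otimes>\<^sub>M \<nu>) (\<lambda>(t, s). ext_log \<bar>t - s\<bar>)";
        cases "ext_integral \<nu> (\<lambda>s. ereal (v s))") auto
  then have "(\<integral>\<^sup>+ z. e2ennreal (- (case z of (t, s) \<Rightarrow> ext_log \<bar>t - s\<bar>)) \<partial>(\<nu> \<Otimes>\<^sub>M \<nu>)) \<noteq> \<infinity>"
    by (rule ext_integral_finiteD)
  then have "AE z in \<nu> \<Otimes>\<^sub>M \<nu>. e2ennreal (- (case z of (t, s) \<Rightarrow> ext_log \<bar>t - s\<bar>)) \<noteq> \<infinity>"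
    by (intro nn_integral_noteq_infinite) auto
  then have "AE z in \<nu> \<Otimes>\<^sub>M \<nu>. z \<notin> {x} \<times> {x}"
    by eventually_elim (auto simp: ext_log_def)
  then have "emeasure (\<nu> \<Otimes>\<^sub>M \<nu>) ({x} \<times> {x}) = 0"
    by (subst (asm) AE_iff_measurable[where N="{x} \<times> {x}"])
      (auto simp: space_pair_measure simp del: insert_Times_insert Sigma_empty2)
  moreover have "emeasure (\<nu> \<Otimes>\<^sub>M \<nu>) ({x} \<times> {x}) = emeasure \<nu> {x} * emeasure \<nu> {x}"
    by (rule emeasure_pair_measure_Times) auto
  ultimately show ?thesis
    by simp
qed

section \<open>The Schwinger-Dyson equation\<close>

lemma difference_quotient_cmult: "difference_quotient (\<lambda>x. c * g x) x y = c * difference_quotient g x y"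
  by (simp add: difference_quotient_def algebra_simps diff_divide_distrib)

lemma difference_quotient_integrable:
  assumes "real_distribution \<nu>" and lip: "L-lipschitz_on UNIV g"
  shows "integrable (\<nu> \<Otimes>\<^sub>M \<nu>) (\<lambda>z. difference_quotient g (fst z) (snd z))"
proof -
  interpret real_distribution \<nu> by fact
  interpret P: pair_prob_space \<nu> \<nu> ..
  have [measurable]: "g \<in> borel_measurable borel"
    by (rule borel_measurable_continuous_onI) (rule lipschitz_on_continuous_on[OF lip])
  have [measurable_cong]: "sets (\<nu> \<Otimes>\<^sub>M \<nu>) = sets (borel \<Otimes>\<^sub>M borel)"
    by (intro sets_pair_measure_cong) auto
  show ?thesis
    by (rule P.integrable_const_bound[where B=L]) (auto simp: difference_quotient_bound[OF lip])
qed

text \<open>Minimality at the perturbation \<open>x + t * g x\<close>, divided by \<open>t\<close>, with the logarithm replaced by its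
  first order term: the error \<open>2 * t * L\<^sup>2\<close> comes from \<open>\<bar>ln (1 + s) - s\<bar> \<le> 2 * s\<^sup>2\<close>.\<close>
lemma difference_quotient_integral_le_perturbation:
  assumes gibbs: "is_free_gibbs v \<nu>" and v: "continuous_on UNIV v"
    and lip: "L-lipschitz_on UNIV g" and supp: "\<And>x. R < \<bar>x\<bar> \<Longrightarrow> g x = 0"
    and t: "0 < t" "t * L \<le> 1/2"
  shows "(\<integral>z. difference_quotient g (fst z) (snd z) \<partial>(\<nu> \<Otimes>\<^sub>M \<nu>))
    \<le> (\<integral>x. (v (x + t * g x) - v x) / t \<partial>\<nu>) + 2 * t * L\<^sup>2"
proof -
  have \<nu>: "real_distribution \<nu>"
    using gibbs by (rule free_gibbs_real_distribution)
  interpret real_distribution \<nu> by fact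
  interpret P: pair_prob_space \<nu> \<nu> ..
  have [measurable_cong]: "sets (\<nu> \<Otimes>\<^sub>M \<nu>) = sets (borel \<Otimes>\<^sub>M borel)"
    by (intro sets_pair_measure_cong) auto
  have L: "0 \<le> L" using lip by (rule lipschitz_on_nonneg)
  have [measurable]: "v \<in> borel_measurable borel"
    using v by (rule borel_measurable_continuous_onI)
  have g: "continuous_on UNIV g"
    using lip by (rule lipschitz_on_continuous_on)
  then have [measurable]: "g \<in> borel_measurable borel"
    by (rule borel_measurable_continuous_onI)
  let ?q = "\<lambda>z. difference_quotient g (fst z) (snd z)"
  let ?N = "\<nu> \<Otimes>\<^sub>M \<nu>"
  have lip_t: "(1/2)-lipschitz_on UNIV (\<lambda>x. t * g x)"
  proof (rule lipschitz_onI)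
    fix x y
    have "t * \<bar>g x - g y\<bar> \<le> t * (L * \<bar>x - y\<bar>)"
      using lipschitz_onD[OF lip, of x y] t by (simp add: dist_real_def)
    also have "\<dots> \<le> 1/2 * \<bar>x - y\<bar>"
      using mult_right_mono[OF t(2), of "\<bar>x - y\<bar>"] by (simp add: mult.assoc)
    finally show "dist (t * g x) (t * g y) \<le> 1/2 * dist x y"
      using t by (simp add: dist_real_def abs_mult flip: right_diff_distrib)
  qed simp
  obtain B where B: "\<And>x. \<bar>v (x + t * g x) - v x\<bar> \<le> B"
    using bounded_perturbation_difference[OF v, of "\<lambda>x. t * g x" R] g supp
    by (fastforce intro: continuous_intros)
  define w where "w = (\<integral>x. v (x + t * g x) - v x \<partial>\<nu>)"
  define d where "d = (\<integral>z. ln (1 + t * ?q z) \<partial>?N)"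
  have "free_energy v \<nu> \<le> free_energy v \<nu> + ereal (w - d)"
    using free_gibbs_minimal[OF gibbs real_distribution_distr_borel[OF \<nu>], of "\<lambda>x. x + t * g x"]
    by (simp add: free_energy_perturbation[where g="\<lambda>x. t * g x" and v=v and B=B, OF \<nu> _ lip_t B] difference_quotient_cmult w_def d_def)
  then have "d \<le> w"
    using free_gibbs_energy_finite[OF gibbs v] by (cases "free_energy v \<nu>") auto
  have tq: "\<bar>t * ?q z\<bar> \<le> 1/2" for z
    using difference_quotient_bound[OF lip_t, of "fst z" "snd z"] by (simp add: difference_quotient_cmult)
  have lower: "t * ?q z - 2 * (t * L)\<^sup>2 \<le> ln (1 + t * ?q z)" for z
  proof -
    have "\<bar>t * ?q z\<bar> \<le> t * L"
      using difference_quotient_bound[OF lip, of "fst z" "snd z"] t by (simp add: abs_mult)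
    then have "(t * ?q z)\<^sup>2 \<le> (t * L)\<^sup>2"
      using L t by (intro abs_le_square_iff[THEN iffD1]) simp
    then show ?thesis using abs_ln_one_plus_x_minus_x_bound[OF tq[of z]] by simp
  qed
  have "t * (\<integral>z. ?q z \<partial>?N) - 2 * (t * L)\<^sup>2 = (\<integral>z. t * ?q z - 2 * (t * L)\<^sup>2 \<partial>?N)"
    using difference_quotient_integrable[OF \<nu> lip] by (simp add: P.prob_space)
  also have "\<dots> \<le> d"
    unfolding d_def
  proof (rule integral_mono)
    show "integrable ?N (\<lambda>z. ln (1 + t * ?q z))"
      by (rule P.integrable_const_bound[where B=1]) (auto intro!: abs_ln_one_plus_le tq)
  qed (use difference_quotient_integrable[OF \<nu> lip] lower in auto)
  also have "\<dots> \<le> w" by fact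
  finally have "(\<integral>z. ?q z \<partial>?N) \<le> w / t + 2 * t * L\<^sup>2"
    using t by (simp add: field_simps power2_eq_square)
  then show ?thesis by (simp add: w_def)
qed

lemma continuous_bounded_on_interval:
  fixes f :: "real \<Rightarrow> real"
  assumes "continuous_on UNIV f"
  shows "\<exists>M\<ge>0. \<forall>x\<in>{a..b}. \<bar>f x\<bar> \<le> M"
proof -
  have "bounded (f ` {a..b})"
    using assms by (intro compact_imp_bounded compact_continuous_image)
      (auto intro: continuous_on_subset)
  then show ?thesis
    unfolding bounded_pos by (auto intro: less_imp_le)
qed

lemma mean_value_bound:
  fixes f f' :: "real \<Rightarrow> real"
  assumes "\<And>x. (f has_real_derivative f' x) (at x)"
    and "\<And>x. x \<in> {a..b} \<Longrightarrow> \<bar>f' x\<bar> \<le> M" and "x \<in> {a..b}" "y \<in> {a..b}"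
  shows "\<bar>f x - f y\<bar> \<le> M * \<bar>x - y\<bar>"
  using field_differentiable_bound[of "{a..b}" f f' M x y] assms
  by (auto intro: has_field_derivative_at_within)

text \<open>Let \<open>t\<close> decrease to \<open>0\<close> in the perturbed inequality. The reverse inequality is the same statement
  for \<open>- g\<close>.\<close>
lemma Schwinger_Dyson_le:
  assumes gibbs: "is_free_gibbs v \<nu>"
    and v: "\<And>x. (v has_real_derivative v' x) (at x)" and v': "continuous_on UNIV v'"
    and lip: "L-lipschitz_on UNIV g" and supp: "\<And>x. R < \<bar>x\<bar> \<Longrightarrow> g x = 0"
  shows "(\<integral>z. difference_quotient g (fst z) (snd z) \<partial>(\<nu> \<Otimes>\<^sub>M \<nu>)) \<le> (\<integral>x. v' x * g x \<partial>\<nu>)"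
proof -
  have \<nu>: "real_distribution \<nu>"
    using gibbs by (rule free_gibbs_real_distribution)
  interpret real_distribution \<nu> by fact
  have L: "0 \<le> L" using lip by (rule lipschitz_on_nonneg)
  have cont_v: "continuous_on UNIV v"
    using v by (meson DERIV_continuous_on has_field_derivative_at_within)
  have g: "continuous_on UNIV g"
    using lip by (rule lipschitz_on_continuous_on)
  have [measurable]: "v \<in> borel_measurable borel" "g \<in> borel_measurable borel"
      "v' \<in> borel_measurable borel"
    using cont_v g v' by (auto intro: borel_measurable_continuous_onI)
  obtain G where G: "G \<ge> 0" "\<And>x. x \<in> {-R..R} \<Longrightarrow> \<bar>g x\<bar> \<le> G"
    using continuous_bounded_on_interval[OF g, of "-R" R] by auto
  obtain M where M: "M \<ge> 0" "\<And>x. x \<in> {-R-G..R+G} \<Longrightarrow> \<bar>v' x\<bar> \<le> M"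
    using continuous_bounded_on_interval[OF v', of "-R-G" "R+G"] by auto
  \<comment> \<open>The shift by \<open>N\<close> keeps \<open>t n * L \<le> 1/2\<close> for all \<open>n\<close>.\<close>
  define N where "N = nat \<lceil>2 * L\<rceil> + 1"
  define t where "t n = 1 / real (n + N)" for n
  have t: "0 < t n" "t n * L \<le> 1/2" "t n \<le> 1" for n
  proof -
    have "2 * L \<le> real N" unfolding N_def by linarith
    then show "t n * L \<le> 1/2" by (auto simp: t_def N_def field_simps)
  qed (auto simp: t_def N_def field_simps)
  have t0: "t \<longlonglongrightarrow> 0"
    unfolding t_def by (rule LIMSEQ_ignore_initial_segment[OF lim_1_over_n])
  have "(\<lambda>n. \<integral>x. (v (x + t n * g x) - v x) / t n \<partial>\<nu>) \<longlonglongrightarrow> (\<integral>x. v' x * g x \<partial>\<nu>)"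
  proof (rule integral_dominated_convergence[where w="\<lambda>_. M * G"])
    show "AE x in \<nu>. (\<lambda>n. (v (x + t n * g x) - v x) / t n) \<longlonglongrightarrow> v' x * g x"
    proof (intro AE_I2)
      fix x
      have "((\<lambda>s. v (x + s * g x)) has_real_derivative v' x * g x) (at 0)"
        by (rule DERIV_chain2[where f=v and g="\<lambda>s. x + s * g x"])
          (auto intro!: derivative_eq_intros v)
      then have "((\<lambda>s. (v (x + s * g x) - v x) / s) \<longlongrightarrow> v' x * g x) (at 0)"
        by (simp add: has_field_derivative_iff)
      moreover have "filterlim t (at 0) sequentially"
        using t0 t(1) by (simp add: filterlim_at less_imp_neq[symmetric])
      ultimately show "(\<lambda>n. (v (x + t n * g x) - v x) / t n) \<longlonglongrightarrow> v' x * g x"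
        by (rule filterlim_compose)
    qed
    show "AE x in \<nu>. norm ((v (x + t n * g x) - v x) / t n) \<le> M * G" for n
    proof (intro AE_I2)
      fix x
      show "norm ((v (x + t n * g x) - v x) / t n) \<le> M * G"
      proof (cases "R < \<bar>x\<bar>")
        case True
        then show ?thesis using supp M G by simp
      next
        case False
        then have "x \<in> {-R..R}" by auto
        then have gx: "\<bar>g x\<bar> \<le> G" by (rule G(2))
        have tg: "\<bar>t n * g x\<bar> \<le> G"
          using mult_mono[OF t(3)[of n] gx] G t(1)[of n] by (simp add: abs_mult)
        have "\<bar>v (x + t n * g x) - v x\<bar> \<le> M * \<bar>x + t n * g x - x\<bar>"
          using False tg G by (intro mean_value_bound[OF v M(2)]) auto
        also have "\<dots> = M * \<bar>g x\<bar> * t n"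
          using t(1)[of n] by (simp add: abs_mult)
        also have "\<dots> \<le> M * G * t n"
          using gx M t(1)[of n] by (intro mult_right_mono mult_left_mono) auto
        finally show ?thesis using t(1)[of n] by (simp add: field_simps)
      qed
    qed
  qed auto
  then have "(\<lambda>n. (\<integral>x. (v (x + t n * g x) - v x) / t n \<partial>\<nu>) + 2 * t n * L\<^sup>2)
      \<longlonglongrightarrow> (\<integral>x. v' x * g x \<partial>\<nu>) + 2 * 0 * L\<^sup>2"
    by (intro tendsto_intros t0)
  moreover have "(\<integral>z. difference_quotient g (fst z) (snd z) \<partial>(\<nu> \<Otimes>\<^sub>M \<nu>))
      \<le> (\<integral>x. (v (x + t n * g x) - v x) / t n \<partial>\<nu>) + 2 * t n * L\<^sup>2" for n
    by (rule difference_quotient_integral_le_perturbation[where R=R, OF gibbs cont_v lip supp t(1,2)])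
  ultimately show ?thesis
    by (intro LIMSEQ_le_const) auto
qed

text \<open>The Euler--Lagrange equation of the free Gibbs measure in weak form, for compactly supported
  Lipschitz test functions.\<close>
lemma Schwinger_Dyson:
  assumes gibbs: "is_free_gibbs v \<nu>"
    and v: "\<And>x. (v has_real_derivative v' x) (at x)" and v': "continuous_on UNIV v'"
    and lip: "L-lipschitz_on UNIV g" and supp: "\<And>x. R < \<bar>x\<bar> \<Longrightarrow> g x = 0"
  shows "(\<integral>z. difference_quotient g (fst z) (snd z) \<partial>(\<nu> \<Otimes>\<^sub>M \<nu>)) = (\<integral>x. v' x * g x \<partial>\<nu>)"
proof (rule antisym)
  show "(\<integral>z. difference_quotient g (fst z) (snd z) \<partial>(\<nu> \<Otimes>\<^sub>M \<nu>)) \<le> (\<integral>x. v' x * g x \<partial>\<nu>)"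
    by (rule Schwinger_Dyson_le[where R=R, OF assms])
  have "(\<integral>z. difference_quotient (\<lambda>x. - g x) (fst z) (snd z) \<partial>(\<nu> \<Otimes>\<^sub>M \<nu>)) \<le> (\<integral>x. v' x * - g x \<partial>\<nu>)"
    using lip supp by (intro Schwinger_Dyson_le[where R=R, OF gibbs v v'] lipschitz_on_minus) auto
  moreover have "difference_quotient (\<lambda>x. - g x) x y = - difference_quotient g x y" for x y
    using difference_quotient_cmult[of "-1" g x y] by simp
  ultimately show "(\<integral>x. v' x * g x \<partial>\<nu>) \<le> (\<integral>z. difference_quotient g (fst z) (snd z) \<partial>(\<nu> \<Otimes>\<^sub>M \<nu>))"
    by simp
qed

section \<open>The defect between the Hilbert kernels of a measure and of its image\<close>

text \<open>The first term is the kernel \<open>1 / (s - t)\<close> of the Hilbert transform, evaluated at \<open>s = T x\<close>,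
  \<open>t = T y\<close> and multiplied by \<open>T' x\<close>; the second one is the same kernel before transport by \<open>T\<close>.
  The two singularities cancel, and what remains is the Laplacian's integrand at \<open>f = T = \<phi>'\<close>.\<close>
definition hilbert_kernel_defect :: "(real \<Rightarrow> real) \<Rightarrow> real \<Rightarrow> real \<Rightarrow> real" where
  "hilbert_kernel_defect T x y = deriv T x / (T x - T y) - 1 / (x - y)"

lemma laplacian_integrand_hilbert_kernel_defect:
  assumes "strict_mono (deriv \<phi>)"
  shows "laplacian_integrand \<phi> (deriv \<phi>) x y = hilbert_kernel_defect (deriv \<phi>) x y"
proof (cases "x = y")
  case False
  then have "deriv \<phi> x - deriv \<phi> y \<noteq> 0" "x - y \<noteq> 0"
    using strict_mono_eq[OF assms] by auto
  moreover have "1 / e * ((c - d / e) / (d / e)) = c / d - 1 / e"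
    if "d \<noteq> 0" "e \<noteq> 0" for c d e :: real
    using that by (simp add: field_simps)
  ultimately show ?thesis
    using False
    by (simp only: laplacian_integrand_def hilbert_kernel_defect_def free_difference_quotient_def if_False)
qed (simp add: laplacian_integrand_def hilbert_kernel_defect_def)

locale C2_increasing =
  fixes T T' T'' :: "real \<Rightarrow> real"
  assumes T: "\<And>x. (T has_real_derivative T' x) (at x)"
    and T': "\<And>x. (T' has_real_derivative T'' x) (at x)"
    and T'': "continuous_on UNIV T''"
    and T'_pos: "\<And>x. 0 < T' x"
begin

lemma deriv_T: "deriv T = T'"
  using T by (auto intro: DERIV_imp_deriv)

lemma strict_mono_T: "strict_mono T"
  using T T'_pos by (meson DERIV_pos_imp_increasing strict_monoI)

lemma continuous_T: "continuous_on A T"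
  using T by (meson DERIV_continuous_on has_field_derivative_at_within)

lemma continuous_T': "continuous_on A T'"
  using T' by (meson DERIV_continuous_on has_field_derivative_at_within)

lemma T_measurable [measurable]: "T \<in> borel_measurable borel" "T' \<in> borel_measurable borel"
  by (auto intro: borel_measurable_continuous_onI continuous_T continuous_T')

lemma derivative_bounds:
  obtains K M where "0 \<le> K" "0 \<le> M"
    "\<And>x. x \<in> {a..b} \<Longrightarrow> 1 / T' x \<le> K" "\<And>x. x \<in> {a..b} \<Longrightarrow> T' x \<le> M"
    "\<And>x. x \<in> {a..b} \<Longrightarrow> \<bar>T'' x\<bar> \<le> M"
proof -
  have "continuous_on UNIV (\<lambda>x. 1 / T' x)"
    using T'_pos by (intro continuous_intros continuous_T') (auto simp: less_imp_neq[symmetric])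
  then obtain K where K: "0 \<le> K" "\<forall>x\<in>{a..b}. \<bar>1 / T' x\<bar> \<le> K"
    using continuous_bounded_on_interval by blast
  obtain M1 where M1: "0 \<le> M1" "\<forall>x\<in>{a..b}. \<bar>T' x\<bar> \<le> M1"
    using continuous_bounded_on_interval[OF continuous_T'] by blast
  obtain M2 where M2: "0 \<le> M2" "\<forall>x\<in>{a..b}. \<bar>T'' x\<bar> \<le> M2"
    using continuous_bounded_on_interval[OF T''] by blast
  show ?thesis
  proof (rule that[of K "max M1 M2"])
    fix x assume x: "x \<in> {a..b}"
    show "1 / T' x \<le> K" using bspec[OF K(2) x] T'_pos[of x] by simp
    show "T' x \<le> max M1 M2" using M1(2) x abs_le_D1 max.coboundedI1 by blast
    show "\<bar>T'' x\<bar> \<le> max M1 M2" using M2(2) x max.coboundedI2 by blast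
  qed (use K(1) M1(1) in auto)
qed

lemma mean_value:
  assumes "x \<noteq> y"
  obtains \<xi> where "T x - T y = (x - y) * T' \<xi>" "min x y < \<xi>" "\<xi> < max x y"
proof (cases "x < y")
  case True
  then obtain z where "x < z" "z < y" "T y - T x = (y - x) * T' z"
    using MVT2[OF True, of T T'] T by auto
  then show ?thesis using that[of z] True by (auto simp: algebra_simps)
next
  case False
  then have "y < x" using assms by simp
  then obtain z where "y < z" "z < x" "T x - T y = (x - y) * T' z"
    using MVT2[of y x T T'] T by auto
  then show ?thesis using that[of z] \<open>y < x\<close> by auto
qed

text \<open>Near the diagonal, write \<open>T x - T y = (x - y) * T' \<xi>\<close>. The defect is then
  \<open>(T' x - T' \<xi>) / ((x - y) * T' \<xi>)\<close>, which is bounded because \<open>T'\<close> is Lipschitz near \<open>x\<close>. Away from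
  the diagonal each term is bounded by itself: \<open>T\<close> is increasing, so \<open>T x - T y\<close> stays away from \<open>0\<close>
  for all \<open>y\<close> at distance at least \<open>1\<close>. Hence the bound is uniform over all real \<open>y\<close>.\<close>
lemma hilbert_kernel_defect_bounded:
  "\<exists>C\<ge>0. \<forall>x\<in>{a..b}. \<forall>y. \<bar>hilbert_kernel_defect T x y\<bar> \<le> C"
proof -
  obtain K M where K: "0 \<le> K" and M: "0 \<le> M"
    and inv: "\<And>x. x \<in> {a-1..b+1} \<Longrightarrow> 1 / T' x \<le> K"
    and up: "\<And>x. x \<in> {a-1..b+1} \<Longrightarrow> T' x \<le> M"
    and up2: "\<And>x. x \<in> {a-1..b+1} \<Longrightarrow> \<bar>T'' x\<bar> \<le> M"
    by (rule derivative_bounds[of "a-1" "b+1"]) blast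
  have "\<bar>hilbert_kernel_defect T x y\<bar> \<le> M * K + 1" if x: "x \<in> {a..b}" for x y
  proof (cases "x = y")
    case True
    then show ?thesis using K M by (simp add: hilbert_kernel_defect_def)
  next
    case False
    show ?thesis
    proof (cases "y \<in> {a-1..b+1}")
      case True
      obtain \<xi> where \<xi>: "T x - T y = (x - y) * T' \<xi>" "min x y < \<xi>" "\<xi> < max x y"
        using mean_value[OF False] .
      have \<xi>_in: "\<xi> \<in> {a-1..b+1}" using \<xi> x True by auto
      have "\<bar>T' x - T' \<xi>\<bar> \<le> M * \<bar>x - \<xi>\<bar>"
        using x \<xi>_in by (intro mean_value_bound[OF T' up2]) auto
      also have "\<dots> \<le> M * \<bar>x - y\<bar>"
        using \<xi> M by (intro mult_left_mono) auto
      finally have diff: "\<bar>T' x - T' \<xi>\<bar> / \<bar>x - y\<bar> \<le> M"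
        using False by (simp add: divide_le_eq)
      have "hilbert_kernel_defect T x y = (T' x - T' \<xi>) / (x - y) * (1 / T' \<xi>)"
        proof -
        have "c / (d * e) - 1 / d = (c - e) / d * (1 / e)" if "d \<noteq> 0" "e \<noteq> 0" for c d e :: real
          using that by (simp add: field_simps)
        from this[of "x - y" "T' \<xi>" "T' x"] show ?thesis
          unfolding hilbert_kernel_defect_def deriv_T \<xi>(1) using False T'_pos[of \<xi>] by simp
      qed
      also have "\<bar>\<dots>\<bar> \<le> M * K"
        unfolding abs_mult using diff inv[OF \<xi>_in] M K T'_pos[of \<xi>]
        by (intro mult_mono) (auto simp: abs_divide)
      finally show ?thesis by simp
    next
      case outside: False
      have far: "1 \<le> \<bar>x - y\<bar>" using outside x by auto
      have gap: "1 \<le> K * \<bar>T x - T y\<bar>"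
      proof -
        \<comment> \<open>the end point of the interval that lies between \<open>x\<close> and \<open>y\<close>\<close>
        define y' where "y' = (if y < x then a - 1 else b + 1)"
        have y': "x \<noteq> y'" "y' \<in> {a-1..b+1}" "1 \<le> \<bar>x - y'\<bar>"
          using x by (auto simp: y'_def)
        obtain \<xi> where \<xi>: "T x - T y' = (x - y') * T' \<xi>" "min x y' < \<xi>" "\<xi> < max x y'"
          using mean_value[OF y'(1)] .
        have "\<xi> \<in> {a-1..b+1}" using \<xi> x y' by auto
        then have "1 \<le> K * T' \<xi>" using inv T'_pos[of \<xi>] by (simp add: divide_le_eq)
        also have "\<dots> \<le> K * (\<bar>x - y'\<bar> * T' \<xi>)"
          using y'(3) K T'_pos[of \<xi>] by (intro mult_left_mono) auto
        also have "\<dots> = K * \<bar>T x - T y'\<bar>"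
          using \<xi>(1) T'_pos[of \<xi>] by (simp add: abs_mult)
        also have "\<bar>T x - T y'\<bar> \<le> \<bar>T x - T y\<bar>"
        proof (cases "y < x")
          case True
          then have "T y \<le> T (a - 1)" "T (a - 1) \<le> T x"
            using outside x by (auto simp: strict_mono_less_eq[OF strict_mono_T])
          then show ?thesis using True by (simp add: y'_def)
        next
          case False
          then have "T (b + 1) \<le> T y" "T x \<le> T (b + 1)"
            using outside x by (auto simp: strict_mono_less_eq[OF strict_mono_T])
          then show ?thesis using False by (simp add: y'_def)
        qed
        finally show ?thesis using K by (simp add: mult_left_mono)
      qed
      then have "T x \<noteq> T y" by auto
      have "\<bar>T' x / (T x - T y)\<bar> \<le> M * K"
      proof -
        have "\<bar>T' x\<bar> * 1 \<le> M * (K * \<bar>T x - T y\<bar>)"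
          using up[of x] x T'_pos[of x] gap M by (intro mult_mono) auto
        then show ?thesis using \<open>T x \<noteq> T y\<close> by (simp add: abs_divide divide_le_eq mult.assoc)
      qed
      moreover have "\<bar>1 / (x - y)\<bar> \<le> 1" using far by (simp add: abs_divide divide_le_eq)
      ultimately show ?thesis unfolding hilbert_kernel_defect_def deriv_T by linarith
    qed
  qed
  then show ?thesis using K M by (intro exI[of _ "M * K + 1"]) auto
qed

lemma hilbert_kernel_defect_measurable [measurable]:
  "(\<lambda>z. hilbert_kernel_defect T (fst z) (snd z)) \<in> borel_measurable (borel \<Otimes>\<^sub>M borel)"
  "hilbert_kernel_defect T x \<in> borel_measurable borel"
  unfolding hilbert_kernel_defect_def deriv_T by measurable

lemma hilbert_kernel_defect_integrable:
  assumes "real_distribution \<nu>"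
  shows "integrable \<nu> (hilbert_kernel_defect T x)"
proof -
  interpret real_distribution \<nu> by fact
  obtain C where "\<And>y. \<bar>hilbert_kernel_defect T x y\<bar> \<le> C"
    using hilbert_kernel_defect_bounded[of x x] by auto
  then show ?thesis by (intro integrable_const_bound[where B=C]) auto
qed

text \<open>The kernel is locally bounded, and continuous in its first argument off the diagonal, which is
  negligible in the absence of atoms.\<close>
lemma isCont_hilbert_kernel_defect_integral:
  assumes \<nu>: "real_distribution \<nu>" and atoms: "\<And>x. emeasure \<nu> {x} = 0"
  shows "isCont (\<lambda>x. \<integral>y. hilbert_kernel_defect T x y \<partial>\<nu>) x"
proof -
  interpret real_distribution \<nu> by fact
  obtain C where C: "0 \<le> C" "\<And>z y. z \<in> {x-1..x+1} \<Longrightarrow> \<bar>hilbert_kernel_defect T z y\<bar> \<le> C"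
    using hilbert_kernel_defect_bounded[of "x-1" "x+1"] by blast
  have "continuous_on {x-1..x+1} (\<lambda>x. \<integral>y. hilbert_kernel_defect T x y \<partial>\<nu>)"
    unfolding continuous_on_sequentially comp_def
  proof (intro allI ballI impI, elim conjE)
    fix X z assume z: "z \<in> {x-1..x+1}" and X: "\<forall>n. X n \<in> {x-1..x+1}" "X \<longlonglongrightarrow> z"
    show "(\<lambda>n. \<integral>y. hilbert_kernel_defect T (X n) y \<partial>\<nu>) \<longlonglongrightarrow> (\<integral>y. hilbert_kernel_defect T z y \<partial>\<nu>)"
    proof (rule integral_dominated_convergence[where w="\<lambda>_. C"])
      have "AE y in \<nu>. y \<noteq> z"
        using atoms[of z] by (intro AE_I[where N="{z}"]) auto
      then show "AE y in \<nu>. (\<lambda>n. hilbert_kernel_defect T (X n) y) \<longlonglongrightarrow> hilbert_kernel_defect T z y"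
      proof eventually_elim
        case (elim y)
        have "T z \<noteq> T y" using elim strict_mono_eq[OF strict_mono_T] by auto
        moreover have "(\<lambda>n. T (X n)) \<longlonglongrightarrow> T z" "(\<lambda>n. T' (X n)) \<longlonglongrightarrow> T' z"
          using X(2) continuous_T[of UNIV] continuous_T'[of UNIV]
          by (auto intro: continuous_on_tendsto_compose)
        ultimately show ?case
          unfolding hilbert_kernel_defect_def deriv_T using elim X(2) by (intro tendsto_intros) auto
      qed
    qed (use X C in auto)
  qed
  then show ?thesis
    by (rule continuous_on_interior) auto
qed

text \<open>A bounded kernel makes the principal value an ordinary integral; only the diagonal point is lost
  in the limit, and it carries no mass.\<close>
lemma hilbert_kernel_defect_pv:
  assumes \<nu>: "real_distribution \<nu>" and atoms: "\<And>x. emeasure \<nu> {x} = 0"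
  shows "pv_exists \<nu> x (hilbert_kernel_defect T x)"
    and "pv_integral \<nu> x (hilbert_kernel_defect T x) = (\<integral>y. hilbert_kernel_defect T x y \<partial>\<nu>)"
proof -
  interpret real_distribution \<nu> by fact
  obtain C where C: "0 \<le> C" "\<And>y. \<bar>hilbert_kernel_defect T x y\<bar> \<le> C"
    using hilbert_kernel_defect_bounded[of x x] by auto
  have lim: "(truncated_integral \<nu> x (hilbert_kernel_defect T x) \<longlongrightarrow> (\<integral>y. hilbert_kernel_defect T x y \<partial>\<nu>)) (at_right 0)"
    unfolding tendsto_at_iff_sequentially comp_def
  proof (intro allI impI)
    fix X :: "nat \<Rightarrow> real" assume X: "\<forall>i. X i \<in> {0<..} - {0}" "X \<longlonglongrightarrow> 0"
    show "(\<lambda>n. truncated_integral \<nu> x (hilbert_kernel_defect T x) (X n)) \<longlonglongrightarrow> (\<integral>y. hilbert_kernel_defect T x y \<partial>\<nu>)"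
      unfolding truncated_integral_def set_lebesgue_integral_def
    proof (rule integral_dominated_convergence[where w="\<lambda>_. C"])
      have "AE y in \<nu>. y \<noteq> x"
        using atoms[of x] by (intro AE_I[where N="{x}"]) auto
      then show "AE y in \<nu>. (\<lambda>n. indicator {y. X n < \<bar>x - y\<bar>} y *\<^sub>R hilbert_kernel_defect T x y)
          \<longlonglongrightarrow> hilbert_kernel_defect T x y"
      proof eventually_elim
        case (elim y)
        have "\<forall>\<^sub>F n in sequentially. X n < \<bar>x - y\<bar>"
          using X(2) elim by (intro order_tendstoD) auto
        then have "\<forall>\<^sub>F n in sequentially.
            indicator {y. X n < \<bar>x - y\<bar>} y *\<^sub>R hilbert_kernel_defect T x y = hilbert_kernel_defect T x y"
          by eventually_elim simp
        then show ?case
          by (rule tendsto_eventually)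
      qed
    qed (use C in \<open>auto simp: indicator_def\<close>)
  qed
  show "pv_exists \<nu> x (hilbert_kernel_defect T x)"
    unfolding pv_exists_def set_integrable_def
  proof (intro conjI allI impI exI)
    fix \<epsilon> :: real
    show "integrable \<nu> (\<lambda>y. indicator {y. \<epsilon> < \<bar>x - y\<bar>} y *\<^sub>R hilbert_kernel_defect T x y)"
      by (rule integrable_mult_indicator[OF _ hilbert_kernel_defect_integrable[OF \<nu>]]) simp
  qed (rule lim)
  show "pv_integral \<nu> x (hilbert_kernel_defect T x) = (\<integral>y. hilbert_kernel_defect T x y \<partial>\<nu>)"
    unfolding pv_integral_def using lim by (intro tendsto_Lim) auto
qed

end

section \<open>The eigenvalue equation\<close>

text \<open>Such a function equals itself precomposed with the projection onto the interval, and the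
  projection is a contraction.\<close>
lemma lipschitz_on_UNIV_if_zero_outside:
  fixes f :: "real \<Rightarrow> real"
  assumes lip: "L-lipschitz_on {a..b} f" and ab: "a \<le> b"
    and zero: "\<And>x. x \<notin> {a<..<b} \<Longrightarrow> f x = 0"
  shows "L-lipschitz_on UNIV f"
proof (rule lipschitz_onI)
  fix x y :: real
  define c where "c z = max a (min b z)" for z
  have c: "f z = f (c z)" "c z \<in> {a..b}" for z
    using ab zero[of z] zero[of "c z"] by (auto simp: c_def max_def min_def)
  have "dist (f x) (f y) \<le> L * dist (c x) (c y)"
    unfolding c(1)[of x] c(1)[of y] by (intro lipschitz_onD[OF lip] c)
  also have "\<dots> \<le> L * dist x y"
    by (intro mult_left_mono lipschitz_on_nonneg[OF lip]) (auto simp: c_def dist_real_def)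
  finally show "dist (f x) (f y) \<le> L * dist x y" .
qed (rule lipschitz_on_nonneg[OF lip])

lemma bounded_of_zero_outside:
  fixes f :: "real \<Rightarrow> real"
  assumes "continuous_on UNIV f" and zero: "\<And>x. R < \<bar>x\<bar> \<Longrightarrow> f x = 0"
  shows "\<exists>B\<ge>0. \<forall>x. \<bar>f x\<bar> \<le> B"
proof -
  obtain B where B: "B \<ge> 0" "\<forall>x\<in>{-R..R}. \<bar>f x\<bar> \<le> B"
    using continuous_bounded_on_interval[OF assms(1)] by blast
  have "\<bar>f x\<bar> \<le> B" for x
  proof (cases "R < \<bar>x\<bar>")
    case False
    then have "x \<in> {-R..R}" by auto
    then show ?thesis using B by blast
  qed (use zero B in simp)
  then show ?thesis using B by blast
qed

context C2_increasing
begin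

text \<open>If \<open>k\<close> tests the image measure and \<open>g = (k \<circ> T) / T'\<close> the original one, the difference of the two
  quotients in the Schwinger--Dyson equations is the symmetrisation of \<open>g x\<close> times the defect.\<close>
lemma difference_quotient_pushforward:
  assumes "\<And>x. k (T x) = g x * T' x"
  shows "difference_quotient k (T x) (T y) - difference_quotient g x y
    = g x * hilbert_kernel_defect T x y + g y * hilbert_kernel_defect T y x"
proof -
  have flip: "hilbert_kernel_defect T y x = - (T' y / (T x - T y) - 1 / (x - y))"
    using minus_divide_right[of "T' y" "T x - T y"] minus_divide_right[of 1 "x - y"]
    by (simp add: hilbert_kernel_defect_def deriv_T)
  show ?thesis
    unfolding difference_quotient_def assms flip hilbert_kernel_defect_def[of T x y] deriv_T
    by (simp add: diff_divide_distrib algebra_simps)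
qed

text \<open>This vanishes at \<open>x\<close> exactly when \<open>T\<close> satisfies the eigenvalue equation at \<open>x\<close>.\<close>
definition eigen_defect :: "(real \<Rightarrow> real) \<Rightarrow> real measure \<Rightarrow> real \<Rightarrow> real" where
  "eigen_defect u' \<nu> x = 2 * (\<integral>y. hilbert_kernel_defect T x y \<partial>\<nu>) - (u' (T x) * T' x - T x)"

text \<open>Subtract the Schwinger--Dyson equation of \<open>\<nu>\<close> with test function \<open>g\<close> from the one of its image under
  \<open>T\<close> with test function \<open>k\<close>. In either equation alone, the term with \<open>g x\<close> and the term
  with \<open>g y\<close> have a singular kernel each. In the difference this kernel is the bounded defect, so the
  two terms can be integrated separately; exchanging \<open>x\<close> and \<open>y\<close> shows that they are equal, and
  Fubini's theorem isolates the factor \<open>g x\<close>.\<close>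
lemma eigen_defect_weakly_zero:
  assumes gibbs_\<phi>: "is_free_gibbs \<phi> \<nu>" and \<phi>: "\<And>x. (\<phi> has_real_derivative T x) (at x)"
    and gibbs_u: "is_free_gibbs u (distr \<nu> borel T)"
    and u: "\<And>x. (u has_real_derivative u' x) (at x)" and u': "continuous_on UNIV u'"
    and g: "L-lipschitz_on UNIV g" "\<And>x. R < \<bar>x\<bar> \<Longrightarrow> g x = 0"
    and k: "L'-lipschitz_on UNIV k" "\<And>s. R' < \<bar>s\<bar> \<Longrightarrow> k s = 0"
    and kg: "\<And>x. k (T x) = g x * T' x"
  shows "has_bochner_integral \<nu> (\<lambda>x. g x * eigen_defect u' \<nu> x) 0"
proof -
  have \<nu>: "real_distribution \<nu>" and \<mu>: "real_distribution (distr \<nu> borel T)"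
    using gibbs_\<phi> gibbs_u by (auto intro: free_gibbs_real_distribution)
  interpret real_distribution \<nu> by fact
  interpret \<mu>: real_distribution "distr \<nu> borel T" by fact
  interpret P: pair_prob_space \<nu> \<nu> ..
  have [measurable_cong]: "sets (\<nu> \<Otimes>\<^sub>M \<nu>) = sets (borel \<Otimes>\<^sub>M borel)"
    by (intro sets_pair_measure_cong) auto
  have cont: "continuous_on UNIV g" "continuous_on UNIV k"
    using g k by (auto intro: lipschitz_on_continuous_on)
  then have [measurable]: "g \<in> borel_measurable borel" "k \<in> borel_measurable borel"
      "u' \<in> borel_measurable borel"
    using u' by (auto intro: borel_measurable_continuous_onI)
  define F where "F z = g (fst z) * hilbert_kernel_defect T (fst z) (snd z)" for z
  have F_meas[measurable]: "F \<in> borel_measurable (borel \<Otimes>\<^sub>M borel)"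
    unfolding F_def by measurable
  obtain G where G: "G \<ge> 0" "\<And>x. \<bar>g x\<bar> \<le> G"
    using bounded_of_zero_outside[OF cont(1) g(2)] by blast
  obtain C where C: "C \<ge> 0" "\<And>x y. x \<in> {-R..R} \<Longrightarrow> \<bar>hilbert_kernel_defect T x y\<bar> \<le> C"
    using hilbert_kernel_defect_bounded[of "-R" R] by blast
  have F_bound: "\<bar>F z\<bar> \<le> G * C" for z
  proof (cases "R < \<bar>fst z\<bar>")
    case True
    then show ?thesis using g(2) G(1) C(1) by (simp add: F_def)
  next
    case False
    then have "fst z \<in> {-R..R}" by auto
    then show ?thesis unfolding F_def abs_mult using G C by (intro mult_mono) auto
  qed
  have F: "integrable (\<nu> \<Otimes>\<^sub>M \<nu>) F"
    by (rule P.integrable_const_bound[where B="G * C"]) (auto simp: F_bound)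
  then have F_swap: "integrable (\<nu> \<Otimes>\<^sub>M \<nu>) (\<lambda>(x, y). F (y, x))"
    by (rule P.integrable_product_swap)
  have iterated: "(\<integral>z. F z \<partial>(\<nu> \<Otimes>\<^sub>M \<nu>)) = (\<integral>x. g x * (\<integral>y. hilbert_kernel_defect T x y \<partial>\<nu>) \<partial>\<nu>)"
    by (subst P.integral_fst'[OF F, symmetric]) (simp add: F_def)
  have inner: "integrable \<nu> (\<lambda>x. g x * (\<integral>y. hilbert_kernel_defect T x y \<partial>\<nu>))"
    using P.integrable_fst'[OF F] by (simp add: F_def)
  have SD_\<nu>: "(\<integral>z. difference_quotient g (fst z) (snd z) \<partial>(\<nu> \<Otimes>\<^sub>M \<nu>)) = (\<integral>x. T x * g x \<partial>\<nu>)"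
    by (rule Schwinger_Dyson[where R=R, OF gibbs_\<phi> \<phi> continuous_T g])
  have pair: "distr \<nu> borel T \<Otimes>\<^sub>M distr \<nu> borel T
      = distr (\<nu> \<Otimes>\<^sub>M \<nu>) (borel \<Otimes>\<^sub>M borel) (\<lambda>(x, y). (T x, T y))"
    by (rule pair_measure_distr) (auto intro: \<mu>.sigma_finite_measure)
  have SD_\<mu>: "(\<integral>z. difference_quotient k (T (fst z)) (T (snd z)) \<partial>(\<nu> \<Otimes>\<^sub>M \<nu>))
      = (\<integral>x. u' (T x) * k (T x) \<partial>\<nu>)"
    using Schwinger_Dyson[where R=R', OF gibbs_u u u' k]
    by (simp add: pair integral_distr case_prod_beta)
  have int_k: "integrable (\<nu> \<Otimes>\<^sub>M \<nu>) (\<lambda>z. difference_quotient k (T (fst z)) (T (snd z)))"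
  proof (rule P.integrable_const_bound[where B=L'])
    show "(\<lambda>z. difference_quotient k (T (fst z)) (T (snd z))) \<in> borel_measurable (\<nu> \<Otimes>\<^sub>M \<nu>)"
      unfolding difference_quotient_def by measurable
  qed (simp add: difference_quotient_bound[OF k(1)])
  have "(\<integral>x. u' (T x) * k (T x) \<partial>\<nu>) - (\<integral>x. T x * g x \<partial>\<nu>)
      = (\<integral>z. F z + (case z of (x, y) \<Rightarrow> F (y, x)) \<partial>(\<nu> \<Otimes>\<^sub>M \<nu>))"
    unfolding SD_\<nu>[symmetric] SD_\<mu>[symmetric]
    by (subst Bochner_Integration.integral_diff[symmetric, OF int_k difference_quotient_integrable[OF \<nu> g(1)]])
      (simp add: difference_quotient_pushforward[OF kg] F_def case_prod_beta)
  also have "\<dots> = 2 * (\<integral>z. F z \<partial>(\<nu> \<Otimes>\<^sub>M \<nu>))"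
    using Bochner_Integration.integral_add[OF F F_swap] P.integral_product_swap[of F] by simp
  finally have balance: "(\<integral>x. u' (T x) * k (T x) \<partial>\<nu>) - (\<integral>x. T x * g x \<partial>\<nu>)
      = 2 * (\<integral>x. g x * (\<integral>y. hilbert_kernel_defect T x y \<partial>\<nu>) \<partial>\<nu>)"
    unfolding iterated .
  have "\<exists>B\<ge>0. \<forall>s. \<bar>u' s * k s\<bar> \<le> B"
    using k(2) by (intro bounded_of_zero_outside[where R=R'] continuous_intros u' cont) auto
  then obtain B where "\<And>s. \<bar>u' s * k s\<bar> \<le> B" by blast
  then have int_u: "integrable \<nu> (\<lambda>x. u' (T x) * k (T x))"
    by (intro integrable_const_bound[where B=B]) auto
  have "\<exists>B\<ge>0. \<forall>s. \<bar>T s * g s\<bar> \<le> B"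
    using g(2) by (intro bounded_of_zero_outside[where R=R] continuous_intros continuous_T cont) auto
  then obtain B' where "\<And>s. \<bar>T s * g s\<bar> \<le> B'" by blast
  then have int_T: "integrable \<nu> (\<lambda>x. T x * g x)"
    by (intro integrable_const_bound[where B=B']) auto
  have "has_bochner_integral \<nu>
      (\<lambda>x. 2 * (g x * (\<integral>y. hilbert_kernel_defect T x y \<partial>\<nu>)) - (u' (T x) * k (T x) - T x * g x))
      (2 * (\<integral>x. g x * (\<integral>y. hilbert_kernel_defect T x y \<partial>\<nu>) \<partial>\<nu>)
        - ((\<integral>x. u' (T x) * k (T x) \<partial>\<nu>) - (\<integral>x. T x * g x \<partial>\<nu>)))"
    by (intro has_bochner_integral_diff has_bochner_integral_mult_right
        has_bochner_integral_integrable inner int_u int_T)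
  moreover have "2 * (g x * (\<integral>y. hilbert_kernel_defect T x y \<partial>\<nu>)) - (u' (T x) * k (T x) - T x * g x)
      = g x * eigen_defect u' \<nu> x" for x
    by (simp add: eigen_defect_def kg algebra_simps)
  ultimately show ?thesis by (simp add: balance)
qed

lemma isCont_eigen_defect:
  assumes "real_distribution \<nu>" "\<And>x. emeasure \<nu> {x} = 0" "continuous_on UNIV u'"
  shows "isCont (eigen_defect u' \<nu>) x"
proof -
  have "isCont T x" "isCont T' x" "isCont u' (T x)"
    using continuous_T[of UNIV] continuous_T'[of UNIV] assms(3)
    by (auto simp: continuous_on_eq_continuous_at)
  then show ?thesis
    unfolding eigen_defect_def[abs_def]
    by (intro continuous_intros isCont_hilbert_kernel_defect_integral assms isCont_o2[where g=u' and f=T]) auto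
qed

text \<open>The test functions for the localisation are hats on the side of the image measure; this is the
  corresponding test function on the side of the original measure.\<close>
lemma hat_pullback_lipschitz:
  assumes ab: "a < b" and \<delta>: "T a \<le> c - \<delta>" "c + \<delta> \<le> T b" "0 < \<delta>"
  defines "g \<equiv> \<lambda>x. max 0 (\<delta> - \<bar>T x - c\<bar>) / T' x"
  shows "\<exists>L. L-lipschitz_on UNIV g" and "\<And>x. x \<notin> {a<..<b} \<Longrightarrow> g x = 0"
proof -
  show zero: "g x = 0" if "x \<notin> {a<..<b}" for x
  proof -
    have "T x \<le> T a \<or> T b \<le> T x"
      using that by (auto simp: strict_mono_less_eq[OF strict_mono_T] not_less)
    then show ?thesis using \<delta> by (auto simp: g_def)
  qed
  obtain K M where K: "0 \<le> K" and M: "0 \<le> M"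
    and inv: "\<And>x. x \<in> {a..b} \<Longrightarrow> 1 / T' x \<le> K"
    and up: "\<And>x. x \<in> {a..b} \<Longrightarrow> T' x \<le> M"
    and up2: "\<And>x. x \<in> {a..b} \<Longrightarrow> \<bar>T'' x\<bar> \<le> M"
    by (rule derivative_bounds[of a b]) blast
  have lip_T: "\<bar>T x - T y\<bar> \<le> M * \<bar>x - y\<bar>" if "x \<in> {a..b}" "y \<in> {a..b}" for x y
    using that up T'_pos by (intro mean_value_bound[OF T]) (auto simp: abs_of_pos)
  have lip_T': "\<bar>T' x - T' y\<bar> \<le> M * \<bar>x - y\<bar>" if "x \<in> {a..b}" "y \<in> {a..b}" for x y
    using that up2 by (intro mean_value_bound[OF T']) auto
  have "(K * M + \<delta> * K * K * M)-lipschitz_on {a..b} g"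
  proof (rule lipschitz_onI)
    fix x y assume xy: "x \<in> {a..b}" "y \<in> {a..b}"
    define h where "h z = max 0 (\<delta> - \<bar>T z - c\<bar>)" for z
    have "\<bar>h x - h y\<bar> \<le> \<bar>T x - T y\<bar>"
      using lipschitz_onD[OF hat_lipschitz[of \<delta> c], of "T x" "T y"]
      by (simp add: h_def dist_real_def)
    then have h: "\<bar>h x - h y\<bar> \<le> M * \<bar>x - y\<bar>" "0 \<le> h y" "h y \<le> \<delta>"
      using lip_T[OF xy] \<delta>(3) by (auto simp: h_def)
    have pos: "0 < T' x" "0 < T' y" by (rule T'_pos)+
    have "g x - g y = 1 / T' x * (h x - h y) + h y * (1 / T' x) * (1 / T' y) * (T' y - T' x)"
      using pos by (simp add: g_def h_def[symmetric] field_simps)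
    also have "\<bar>\<dots>\<bar> \<le> \<bar>1 / T' x * (h x - h y)\<bar> + \<bar>h y * (1 / T' x) * (1 / T' y) * (T' y - T' x)\<bar>"
      by (rule abs_triangle_ineq)
    also have "\<dots> = 1 / T' x * \<bar>h x - h y\<bar> + h y * (1 / T' x) * (1 / T' y) * \<bar>T' y - T' x\<bar>"
      using pos h by (simp add: abs_mult)
    also have "\<dots> \<le> K * (M * \<bar>x - y\<bar>) + \<delta> * K * K * (M * \<bar>x - y\<bar>)"
      using pos h xy inv K M \<delta>(3) lip_T'[OF xy]
      by (intro add_mono mult_mono mult_nonneg_nonneg) (auto simp: abs_minus_commute)
    finally show "dist (g x) (g y) \<le> (K * M + \<delta> * K * K * M) * dist x y"
      by (simp add: dist_real_def algebra_simps)
  qed (use K M \<delta> in auto)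
  then show "\<exists>L. L-lipschitz_on UNIV g"
    using lipschitz_on_UNIV_if_zero_outside ab zero by (metis less_imp_le)
qed

text \<open>The defect is continuous and integrates to zero against nonnegative test functions concentrated
  near \<open>x0\<close>. If it had a sign at \<open>x0\<close>, it would keep this sign on an interval around \<open>x0\<close>, and a hat
  inside this interval would show that a neighbourhood of \<open>x0\<close> is a null set.\<close>
lemma eigen_defect_zero_on_support:
  assumes gibbs_\<phi>: "is_free_gibbs \<phi> \<nu>" and \<phi>: "\<And>x. (\<phi> has_real_derivative T x) (at x)"
    and gibbs_u: "is_free_gibbs u (distr \<nu> borel T)"
    and u: "\<And>x. (u has_real_derivative u' x) (at x)" and u': "continuous_on UNIV u'"
    and x0: "x0 \<in> measure_support \<nu>"
  shows "eigen_defect u' \<nu> x0 = 0"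
proof (rule ccontr)
  let ?\<Psi> = "eigen_defect u' \<nu>"
  assume nz: "?\<Psi> x0 \<noteq> 0"
  have \<nu>: "real_distribution \<nu>"
    using gibbs_\<phi> by (rule free_gibbs_real_distribution)
  interpret real_distribution \<nu> by fact
  have "continuous_on UNIV \<phi>"
    using \<phi> by (meson DERIV_continuous_on has_field_derivative_at_within)
  then have atoms: "emeasure \<nu> {x} = 0" for x
    using gibbs_\<phi> by (intro free_gibbs_no_atoms)
  have "isCont (\<lambda>x. ?\<Psi> x * ?\<Psi> x0) x0"
    by (intro continuous_intros isCont_eigen_defect \<nu> atoms u')
  moreover have "?\<Psi> x0 * ?\<Psi> x0 > 0" using nz by (simp flip: power2_eq_square)
  ultimately have "\<forall>\<^sub>F x in at x0. ?\<Psi> x * ?\<Psi> x0 > 0"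
    by (intro order_tendstoD) (auto simp: isCont_def)
  then obtain d where d: "d > 0" "\<And>x. dist x x0 < d \<Longrightarrow> ?\<Psi> x * ?\<Psi> x0 > 0"
    using \<open>?\<Psi> x0 * ?\<Psi> x0 > 0\<close> unfolding eventually_at by (metis UNIV_I)
  define a b where "a = x0 - d" and "b = x0 + d"
  \<comment> \<open>Multiplying by the value at \<open>x0\<close> treats both signs at once.\<close>
  have pos: "?\<Psi> x * ?\<Psi> x0 > 0" if "x \<in> {a<..<b}" for x
    using that by (intro d(2)) (auto simp: a_def b_def dist_real_def)
  \<comment> \<open>small enough for the hat at \<open>T x0\<close> to live on the image of \<open>{a<..<b}\<close>\<close>
  define \<delta> where "\<delta> = min (T x0 - T a) (T b - T x0)"
  have \<delta>: "T a \<le> T x0 - \<delta>" "T x0 + \<delta> \<le> T b" "0 < \<delta>"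
    using d(1) by (auto simp: \<delta>_def a_def b_def strict_mono_less[OF strict_mono_T])
  define k where "k s = max 0 (\<delta> - \<bar>s - T x0\<bar>)" for s
  define g where "g x = max 0 (\<delta> - \<bar>T x - T x0\<bar>) / T' x" for x
  have "a < b" using d(1) by (simp add: a_def b_def)
  note hat = hat_pullback_lipschitz[OF this \<delta>, folded g_def]
  obtain L where L: "L-lipschitz_on UNIV g" using hat(1) by blast
  have g0: "g x = 0" if "\<bar>x0\<bar> + d < \<bar>x\<bar>" for x
    using that by (intro hat(2)) (auto simp: a_def b_def)
  have int: "has_bochner_integral \<nu> (\<lambda>x. g x * ?\<Psi> x) 0"
  proof (rule eigen_defect_weakly_zero[OF gibbs_\<phi> \<phi> gibbs_u u u' L g0])
    show "1-lipschitz_on UNIV k"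
      unfolding k_def by (rule hat_lipschitz)
    show "k s = 0" if "\<bar>T x0\<bar> + \<delta> < \<bar>s\<bar>" for s
      using that by (auto simp: k_def)
    show "k (T x) = g x * T' x" for x
      using T'_pos[of x] by (simp add: k_def g_def)
  qed
  have nonneg: "0 \<le> g x * ?\<Psi> x * ?\<Psi> x0" for x
  proof (cases "x \<in> {a<..<b}")
    case True
    have "0 \<le> g x" using T'_pos[of x] by (simp add: g_def)
    then show ?thesis using pos[OF True] by (simp add: mult.assoc)
  qed (use hat(2) in simp)
  have null: "AE x in \<nu>. g x * ?\<Psi> x * ?\<Psi> x0 = 0"
    using int nonneg
    by (subst integral_nonneg_eq_0_iff_AE[symmetric])
      (auto simp: has_bochner_integral_iff)
  define U where "U = T -` {T x0 - \<delta><..<T x0 + \<delta>}"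
  have U_nz: "g x * ?\<Psi> x * ?\<Psi> x0 \<noteq> 0" if "x \<in> U" for x
  proof -
    have "0 < \<delta> - \<bar>T x - T x0\<bar>" using that by (auto simp: U_def)
    then have "0 < g x" using T'_pos[of x] by (simp add: g_def)
    moreover from this have "x \<in> {a<..<b}" using hat(2)[of x] by auto
    ultimately show ?thesis using pos[of x] by auto
  qed
  have "AE x in \<nu>. x \<notin> U"
    using null by eventually_elim (use U_nz in auto)
  moreover have U: "open U" "x0 \<in> U"
    unfolding U_def using \<delta>(3) continuous_T[of UNIV]
    by (auto intro!: open_vimage)
  ultimately have "emeasure \<nu> U = 0"
    by (subst (asm) AE_iff_measurable[where N=U]) auto
  then show False
    using x0 U by (auto simp: measure_support_def)
qed

end

section \<open>Support, smoothness and conclusion\<close>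

text \<open>The complement of the support is a null set, being a countable union of open null sets
  (Lindelof). So the support cannot be contained in a single point without mass.\<close>
lemma exists_support_point_not:
  assumes \<nu>: "real_distribution \<nu>" and atom: "emeasure \<nu> {z} = 0"
  shows "\<exists>x\<in>measure_support \<nu>. x \<noteq> z"
proof (rule ccontr)
  interpret real_distribution \<nu> by fact
  assume neg: "\<not> ?thesis"
  define \<U> where "\<U> = {U. open U \<and> emeasure \<nu> U = 0}"
  obtain \<V> where \<V>: "\<V> \<subseteq> \<U>" "countable \<V>" "\<Union>\<V> = \<Union>\<U>"
    by (rule Lindelof[of \<U>]) (auto simp: \<U>_def)
  have "(\<Union>V\<in>\<V>. V) \<in> null_sets \<nu>"
    using \<V>(1,2) by (intro null_sets_UN') (auto simp: \<U>_def null_sets_def)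
  then have "AE x in \<nu>. x \<notin> \<Union>\<U>"
    using \<V>(3) by (intro AE_not_in) simp
  moreover have "AE x in \<nu>. x \<noteq> z"
    using atom by (intro AE_I[where N="{z}"]) auto
  ultimately have "AE x in \<nu>. False"
  proof eventually_elim
    case (elim x)
    then show ?case using neg by (auto simp: measure_support_def \<U>_def)
  qed
  then show False by simp
qed

lemma class_C_imp_DERIV:
  assumes "class_C n f" "j < n"
  shows "((deriv ^^ j) f has_real_derivative (deriv ^^ Suc j) f x) (at x)"
  using assms by (simp add: class_C_def DERIV_deriv_iff_real_differentiable)

lemma class_C_imp_continuous:
  assumes "class_C n f" "j \<le> n"
  shows "continuous_on UNIV ((deriv ^^ j) f)"
proof (cases "j = n")
  case False
  then have "j < n" using assms(2) by simp
  then show ?thesis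
    using class_C_imp_DERIV[OF assms(1)] by (meson DERIV_continuous_on has_field_derivative_at_within)
qed (use assms in \<open>simp add: class_C_def\<close>)

lemma class_C_deriv:
  assumes "class_C n f" "Suc k \<le> n"
  shows "class_C k (deriv f)"
proof -
  have shift: "(deriv ^^ j) (deriv f) = (deriv ^^ Suc j) f" for j
    by (simp only: funpow_Suc_right comp_apply)
  then show ?thesis
    unfolding class_C_def
  proof (intro conjI allI impI)
    fix j x assume "j < k"
    then have "Suc j < n" using assms(2) by simp
    then show "((deriv ^^ j) (deriv f)) differentiable (at x)"
      using assms(1) shift unfolding class_C_def by metis
  qed (simp only: shift class_C_imp_continuous[OF assms])
qed

lemma carre_du_champ_deriv:
  "carre_du_champ \<phi> (deriv \<phi>) (deriv \<phi>) = free_difference_quotient (deriv \<phi>)"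
proof (intro ext)
  fix x y
  show "carre_du_champ \<phi> (deriv \<phi>) (deriv \<phi>) x y = free_difference_quotient (deriv \<phi>) x y"
    by (cases "free_difference_quotient (deriv \<phi>) x y = 0") (simp_all add: carre_du_champ_def)
qed

theorem proposition5:
  fixes u \<phi> :: "real \<Rightarrow> real" and \<kappa> :: real and \<mu> \<nu> :: "real measure"
  assumes "class_C 3 u"
    and "\<kappa> > 0"
    and "\<And>x. (deriv ^^ 2) u x > \<kappa>"
    and "is_free_gibbs u \<mu>"
    and "centered \<mu>"
    and "is_free_moment_map \<mu> \<phi>"
    and "is_free_gibbs \<phi> \<nu>"
    and "class_C 4 \<phi>"
    and "\<And>x. (deriv ^^ 2) \<phi> x > 0"
  shows "laplacian_eigenfunction u \<phi> \<nu> (deriv \<phi>) (-1) \<and>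
    (\<forall>x\<in>measure_support \<nu>. laplacian u \<phi> \<nu> (deriv \<phi>) x = - deriv \<phi> x) \<and>
    carre_du_champ \<phi> (deriv \<phi>) (deriv \<phi>) = free_difference_quotient (deriv \<phi>)"
proof -
  let ?T = "deriv \<phi>"
  have \<phi>: "(\<phi> has_real_derivative ?T x) (at x)" for x
    using class_C_imp_DERIV[OF assms(8), of 0] by simp
  interpret C2_increasing ?T "(deriv ^^ 2) \<phi>" "(deriv ^^ 3) \<phi>"
  proof
    show "(?T has_real_derivative (deriv ^^ 2) \<phi> x) (at x)" for x
      using class_C_imp_DERIV[OF assms(8), of 1] by (simp add: numeral_2_eq_2)
    show "((deriv ^^ 2) \<phi> has_real_derivative (deriv ^^ 3) \<phi> x) (at x)" for x
      using class_C_imp_DERIV[OF assms(8), of 2] by (simp add: eval_nat_numeral)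
  qed (use assms(9) class_C_imp_continuous[OF assms(8)] in auto)
  have u: "(u has_real_derivative deriv u x) (at x)" for x
    using class_C_imp_DERIV[OF assms(1), of 0] by simp
  have u': "continuous_on UNIV (deriv u)"
    using class_C_imp_continuous[OF assms(1), of 1] by simp
  have \<nu>: "real_distribution \<nu>"
    using assms(7) by (rule free_gibbs_real_distribution)
  have atoms: "emeasure \<nu> {x} = 0" for x
    using class_C_imp_continuous[OF assms(8), of 0] by (intro free_gibbs_no_atoms[OF assms(7)]) simp
  obtain \<nu>' where "is_free_gibbs \<phi> \<nu>'" "\<mu> = distr \<nu>' borel ?T"
    using assms(6) by (auto simp: is_free_moment_map_def)
  moreover from this have "\<nu>' = \<nu>"
    using assms(7) by (auto simp: is_free_gibbs_def)
  ultimately have gibbs_u: "is_free_gibbs u (distr \<nu> borel ?T)"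
    using assms(4) by simp
  note integrand = laplacian_integrand_hilbert_kernel_defect[OF strict_mono_T, abs_def]
  have pv: "pv_exists \<nu> x (laplacian_integrand \<phi> ?T x)"
    and lap: "laplacian u \<phi> \<nu> ?T x
      = 2 * (\<integral>y. hilbert_kernel_defect ?T x y \<partial>\<nu>) - (deriv ^^ 2) \<phi> x * deriv u (?T x)" for x
    using hilbert_kernel_defect_pv[OF \<nu> atoms, of x]
    by (simp_all add: laplacian_def integrand deriv_T)
  have eigen: "laplacian u \<phi> \<nu> ?T x = - ?T x" if "x \<in> measure_support \<nu>" for x
    using eigen_defect_zero_on_support[OF assms(7) \<phi> gibbs_u u u' that]
    by (simp add: lap eigen_defect_def mult.commute)
  have "\<exists>x\<in>measure_support \<nu>. ?T x \<noteq> 0"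
  proof -
    obtain z where z: "z \<in> measure_support \<nu>"
      using exists_support_point_not[OF \<nu> atoms] by blast
    obtain y where "y \<in> measure_support \<nu>" "y \<noteq> z"
      using exists_support_point_not[OF \<nu> atoms] by blast
    with z show ?thesis using strict_mono_eq[OF strict_mono_T, of y z] by metis
  qed
  then show ?thesis
    using eigen pv class_C_deriv[OF assms(8), of 2]
    by (simp add: laplacian_eigenfunction_def carre_du_champ_deriv)
qed

end
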